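(* Let $T=T_\alpha$ be the square-tiled interval exchange transformation with permutations $p_l,p_r$ of $\{1,\dots,d\}$ and irrational angle $\alpha\in(0,1)$. If $\alpha$ has bounded partial quotients, there exists a constant $C>0$ such that the following holds for any integer $e$ with $e\le d$ and $e\ge 1+\#\{i\in\{1,\dots,d\}:\ p_lp_r i= p_rp_l i\}$. Let $v_i$ and $v'_i$, $1\le i\le e$, be words in $L(T)$, all of equal length $q$, such that (1) $\sum_{i=1}^e \bar d(v_i,v'_i)<C$; (2) $\phi(v_i)$ is the same word $u$ for all $i$; (3) $\phi(v'_i)$ is the same word $u'$ for all $i$; (4) $v_i\neq v_j$ for $i\neq j$. Then $\{1,\dots,q\}$ is the disjoint union of three (possibly empty) integer intervals $I_1$, $J_1$, $I_2$ (in increasing order) such that (a) $v_{i,J_1}=v'_{i,J_1}$ for all $i$; (b) $\sum_{i=1}^e\bar d(v_{i,I_1},v'_{i,I_1})\ge 1$ if $I_1$ is nonempty; (c) $\sum_{i=1}^e\bar d(v_{i,I_2},v'_{i,I_2})\ge 1$ if $I_2$ is nonempty, where $z_{i,H}$ denotes the word made with the $h$-th letters of the word $z_i$ for all $h$ in $H$. In particular $\#J_1\ge q\left(1-\sum_{i=1}^e\bar d(v_i,v'_i)\right)$.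
   Context: Let $p_l,p_r$ be permutations of $\{1,\dots,d\}$ and $\alpha\in(0,1)$. The square-tiled interval exchange transformation $T=T_\alpha$ acts on $[0,1[\times\{1,\dots,d\}$ by $T(x,i)=(x+\alpha \bmod 1,\ \phi_x(i))$, where $\phi_x=p_l^{-1}$ if $x\in[0,1-\alpha[$ and $\phi_x=p_r^{-1}$ if $x\in[1-\alpha,1[$. Natural coding: use the alphabet $\{i_l,i_r: 1\le i\le d\}$. The trajectory of a point is the sequence $(x_n)_{n\ge0}$ where $x_n=i_l$ if the $n$-th iterate of the point lies in $[0,1-\alpha[\times\{i\}$ and $x_n=i_r$ if it lies in $[1-\alpha,1[\times\{i\}$. $L(T)$ is the set of all finite factors (blocks of consecutive letters) of all trajectories. For a word $w$ on this alphabet, $\phi(w)$ is the word on $\{l,r\}$ obtained by replacing each $i_l$ by $l$ and each $i_r$ by $r$. For two words $w=w_1\dots w_q$, $w'=w'_1\dots w'_q$ of equal length $q\ge1$, $\bar d(w,w')=\frac1q\#\{i:\ w_i\ne w'_i\}$. An irrational number has bounded partial quotients if the partial quotients of its continued fraction expansion form a bounded sequence. *)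

theory Defs
  imports Complex_Main "HOL-Combinatorics.Permutations"
begin

text \<open>Complete quotients and partial quotients of the regular continued fraction
  \<open>x = a\<^sub>0 + 1 / (a\<^sub>1 + 1 / (a\<^sub>2 + \<dots>))\<close>. They are only meaningful for irrational \<open>x\<close>:
  for rational \<open>x\<close> the recursion eventually divides by zero.\<close>

fun complete_quotient :: "real \<Rightarrow> nat \<Rightarrow> real" where
  "complete_quotient x 0 = x"
| "complete_quotient x (Suc n) = 1 / frac (complete_quotient x n)"

definition partial_quotient :: "real \<Rightarrow> nat \<Rightarrow> int" where
  "partial_quotient x n = \<lfloor>complete_quotient x n\<rfloor>"

definition bounded_partial_quotients :: "real \<Rightarrow> bool" where
  "bounded_partial_quotients x \<longleftrightarrow> (\<exists>B. \<forall>n. \<bar>partial_quotient x n\<bar> \<le> B)"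

text \<open>The map acts on \<open>{0..<1} \<times> {1..d}\<close>; permutations of \<open>{1..d}\<close> are functions on \<open>nat\<close>
  fixing everything outside \<open>{1..d}\<close>, so \<open>inv\<close> is the inverse permutation.\<close>

definition sq_tiled_iet ::
  "real \<Rightarrow> (nat \<Rightarrow> nat) \<Rightarrow> (nat \<Rightarrow> nat) \<Rightarrow> real \<times> nat \<Rightarrow> real \<times> nat" where
  "sq_tiled_iet \<alpha> p\<^sub>l p\<^sub>r = (\<lambda>(x, i). (frac (x + \<alpha>), if x < 1 - \<alpha> then inv p\<^sub>l i else inv p\<^sub>r i))"

datatype side = L | R

text \<open>The letter \<open>i\<^sub>l\<close> is \<open>(i, L)\<close> and \<open>i\<^sub>r\<close> is \<open>(i, R)\<close>.\<close>

type_synonym letter = "nat \<times> side"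

definition letter_of :: "real \<Rightarrow> real \<times> nat \<Rightarrow> letter" where
  "letter_of \<alpha> = (\<lambda>(x, i). (i, if x < 1 - \<alpha> then L else R))"

definition trajectory ::
  "real \<Rightarrow> (nat \<Rightarrow> nat) \<Rightarrow> (nat \<Rightarrow> nat) \<Rightarrow> real \<times> nat \<Rightarrow> nat \<Rightarrow> letter" where
  "trajectory \<alpha> p\<^sub>l p\<^sub>r z n = letter_of \<alpha> ((sq_tiled_iet \<alpha> p\<^sub>l p\<^sub>r ^^ n) z)"

definition language ::
  "nat \<Rightarrow> real \<Rightarrow> (nat \<Rightarrow> nat) \<Rightarrow> (nat \<Rightarrow> nat) \<Rightarrow> letter list set" where
  "language d \<alpha> p\<^sub>l p\<^sub>r =
     {map (trajectory \<alpha> p\<^sub>l p\<^sub>r z) [k..<k + n] | z k n. z \<in> {0..<1} \<times> {1..d}}"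

definition side_word :: "letter list \<Rightarrow> side list" where
  "side_word w = map snd w"

text \<open>Only used for words of equal length; it is \<open>0\<close> for empty words.\<close>

definition dbar :: "'a list \<Rightarrow> 'a list \<Rightarrow> real" where
  "dbar w w' = real (card {i. i < length w \<and> w ! i \<noteq> w' ! i}) / real (length w)"

text \<open>Positions in \<open>H\<close> are counted from \<open>1\<close>, list positions from \<open>0\<close>.\<close>

definition subword :: "'a list \<Rightarrow> nat set \<Rightarrow> 'a list" where
  "subword w H = nths w {k. Suc k \<in> H}"

end

theory Submission
  imports Defs "HOL-Analysis.Kronecker_Approximation_Theorem"
begin

text \<open>The side words \<open>u\<close> and \<open>u'\<close> code two orbits of the rotation by \<open>\<alpha>\<close> at a constant distance
  \<open>\<delta>\<close>. For small \<open>\<delta>\<close> they differ only at isolated pairs of positions where one reads \<open>LR\<close> and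
  the other \<open>RL\<close>; since \<open>\<alpha>\<close> has bounded partial quotients, the gaps between these exchanges lie
  between \<open>c / \<delta>\<close> and \<open>K / \<delta>\<close>. Call a position good if all \<open>v\<^sub>i\<close> and \<open>v'\<^sub>i\<close> agree there. If all
  positions before an exchange are good, then after it the indices are moved by the two products of the
  permutations, and as \<open>e\<close> exceeds the number of points where these commute, some \<open>i\<close> is mismatched until
  the next exchange. So two stretches of good positions, each of length at most \<open>K / \<delta>\<close>, are separated
  by at least \<open>c / \<delta>\<close> bad positions: if there are two of them, the bad positions have a density
  bounded below, which a small \<open>C\<close> excludes. Hence the good positions form one interval.\<close>

section \<open>Diophantine properties of bounded partial quotients\<close>

text \<open>The induction follows the Gauss map \<open>y \<mapsto> frac (1 / y)\<close>. The quotient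
  \<open>\<bar>k y - p\<bar> (k + p \<theta>) / (1 + y \<theta>)\<close> is unchanged when \<open>(k, p, y, \<theta>)\<close> is replaced by
  \<open>(p, k - p a, 1 / y - a, 1 / (a + \<theta>))\<close>, so no constant is lost from one step to the next;
  with \<open>\<theta> = 0\<close> throughout, the induction would not close.\<close>

lemma badly_approximable_gauss_invariant:
  fixes Y :: "real set" and c :: real
  assumes "0 < c"
    and lower: "\<And>y. y \<in> Y \<Longrightarrow> 2 * c \<le> y"
    and upper: "\<And>y. y \<in> Y \<Longrightarrow> y \<le> 1 - 2 * c"
    and gauss: "\<And>y. y \<in> Y \<Longrightarrow> frac (1 / y) \<in> Y"
    and "y \<in> Y" "0 < k" "0 \<le> p" "0 \<le> \<theta>" "\<theta> \<le> 1"
  shows "c * (1 + y * \<theta>) \<le> \<bar>real k * y - of_int p\<bar> * (real k + of_int p * \<theta>)"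
  using assms(5-)
proof (induction k arbitrary: y p \<theta> rule: less_induct)
  case (less k)
  have y: "0 < y" "y < 1" "2 * c \<le> y" "y \<le> 1 - 2 * c"
    using lower[OF less.prems(1)] upper[OF less.prems(1)] \<open>0 < c\<close> by auto
  have "y * \<theta> \<le> 1"
    using y less.prems by (simp add: mult_le_one)
  then have rhs: "c * (1 + y * \<theta>) \<le> 2 * c"
    using \<open>0 < c\<close> by simp
  have large: "real k + of_int p * \<theta> \<ge> 1"
    using less.prems by (simp add: add_increasing2)
  \<comment> \<open>Distance \<open>2 * c\<close> suffices because \<open>k + p * \<theta>\<close>
    is at least 1 and \<open>1 + y * \<theta>\<close> at most 2. Every case except
    \<open>0 < p < k\<close> with \<open>p * a \<le> k\<close> reduces to this.\<close>
  have easy: ?case if "2 * c \<le> \<bar>real k * y - of_int p\<bar>"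
  proof -
    have "2 * c * 1 \<le> \<bar>real k * y - of_int p\<bar> * (real k + of_int p * \<theta>)"
      by (rule mult_mono) (use that large \<open>0 < c\<close> in auto)
    then show ?thesis using rhs by linarith
  qed
  have ky: "y \<le> real k * y"
    using y less.prems by simp
  consider "p = 0" | "p \<ge> int k" | "0 < p" "p < int k"
    using less.prems by linarith
  then show ?case
  proof cases
    case 1
    have "2 * c \<le> \<bar>real k * y - of_int p\<bar>"
      unfolding 1 using order_trans[OF y(3) ky] by linarith
    then show ?thesis by (rule easy)
  next
    case 2
    have "1 * (1 - y) \<le> real k * (1 - y)"
      by (rule mult_right_mono) (use y less.prems in auto)
    moreover have "real k \<le> of_int p" using 2 by linarith
    ultimately have "1 - y \<le> of_int p - real k * y"
      by (simp add: algebra_simps)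
    then show ?thesis using y by (intro easy) auto
  next
    case 3
    define a where "a = \<lfloor>1 / y\<rfloor>"
    have ay: "of_int a * y \<le> 1"
      using y unfolding a_def by (metis of_int_floor_le pos_le_divide_eq)
    have a1: "1 \<le> a"
      using y unfolding a_def by simp
    show ?thesis
    proof (cases "int k < p * a")
      case True
      then have "int k + 1 \<le> p * a" by simp
      then have "real k + 1 \<le> of_int p * of_int a"
        by (metis of_int_1 of_int_add of_int_le_iff of_int_mult of_int_of_nat_eq)
      then have "(real k + 1) * y \<le> of_int p * of_int a * y"
        using y by (intro mult_right_mono) auto
      also have "\<dots> \<le> of_int p * 1"
        unfolding mult.assoc by (rule mult_left_mono) (use ay 3 in auto)
      finally have "y \<le> of_int p - real k * y"
        by (simp add: algebra_simps)
      then show ?thesis using y by (intro easy) auto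
    next
      \<comment> \<open>Now \<open>p < k\<close> and \<open>k - p * a \<ge> 0\<close>, so the
        induction hypothesis applies one step along the Gauss map.\<close>
      case False
      define \<theta>' where "\<theta>' = 1 / (of_int a + \<theta>)"
      define y' where "y' = frac (1 / y)"
      have y': "y' = 1 / y - of_int a"
        unfolding y'_def a_def frac_def ..
      have a\<theta>: "of_int a + \<theta> \<ge> 1"
        using a1 less.prems by (simp add: add_increasing2)
      have \<theta>': "0 \<le> \<theta>'" "\<theta>' \<le> 1" "0 < \<theta>'"
        using a\<theta> unfolding \<theta>'_def by auto
      have IH: "c * (1 + y' * \<theta>') \<le>
          \<bar>real (nat p) * y' - of_int (int k - p * a)\<bar> * (real (nat p) + of_int (int k - p * a) * \<theta>')"
        by (rule less.IH) (use 3 False \<theta>' less.prems gauss in \<open>auto simp: y'_def\<close>)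
      have 1: "1 + y' * \<theta>' = (1 + y * \<theta>) * (\<theta>' / y)"
        unfolding y' \<theta>'_def using y a\<theta> by (simp add: divide_simps) (simp add: algebra_simps)
      have "real (nat p) * y' - of_int (int k - p * a) = - (real k * y - of_int p) / y"
        unfolding y' using 3 y by (simp add: field_simps)
      then have 2: "\<bar>real (nat p) * y' - of_int (int k - p * a)\<bar> = \<bar>real k * y - of_int p\<bar> / y"
        using y by (simp add: abs_divide)
      have 3: "real (nat p) + of_int (int k - p * a) * \<theta>' = (real k + of_int p * \<theta>) * \<theta>'"
        unfolding \<theta>'_def using 3 a\<theta> by (simp add: field_simps)
      have "c * (1 + y * \<theta>) * (\<theta>' / y) \<le>
          \<bar>real k * y - of_int p\<bar> * (real k + of_int p * \<theta>) * (\<theta>' / y)"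
        using IH unfolding 1 2 3 by (simp add: mult_ac)
      then show ?thesis
        by (rule mult_right_le_imp_le) (use \<theta>' y in simp)
    qed
  qed
qed

section \<open>From bounded partial quotients to bad approximability and evenly spread
  orbits\<close>

lemma complete_quotient_irrational:
  "x \<notin> \<rat> \<Longrightarrow> complete_quotient x n \<notin> \<rat>"
proof (induction n)
  case (Suc n)
  then have irr: "complete_quotient x n \<notin> \<rat>" by simp
  show ?case
  proof
    assume "complete_quotient x (Suc n) \<in> \<rat>"
    then have "inverse (complete_quotient x (Suc n)) \<in> \<rat>"
      by (rule Rats_inverse)
    then have "frac (complete_quotient x n) + of_int \<lfloor>complete_quotient x n\<rfloor> \<in> \<rat>"
      by (intro Rats_add) auto
    then show False using irr by (simp add: frac_def)
  qed
qed simp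

text \<open>The fractional parts of the complete quotients form an orbit of the Gauss map. Bounded
  partial quotients keep this orbit away from 0 and 1, so the invariant estimate applies with
  \<open>\<theta> = 0\<close>.\<close>

lemma badly_approximable_if_bounded_partial_quotients:
  fixes \<alpha> :: real
  assumes "0 < \<alpha>" "\<alpha> < 1" "\<alpha> \<notin> \<rat>" "bounded_partial_quotients \<alpha>"
  obtains c where "0 < c" "\<And>k p. 0 < k \<Longrightarrow> c \<le> real k * \<bar>real k * \<alpha> - of_int p\<bar>"
proof -
  obtain B where B: "\<And>n. \<bar>partial_quotient \<alpha> n\<bar> \<le> B"
    using assms(4) unfolding bounded_partial_quotients_def by auto
  define Y where "Y = range (\<lambda>n. frac (complete_quotient \<alpha> n))"
  have B0: "0 \<le> B" using B[of 0] by linarith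
  \<comment> \<open>Every \<open>y\<close> in \<open>Y\<close> is at least
    \<open>1 / (B + 1) = 4 * c\<close>; the spare factor 2 pays for the bound near 1.\<close>
  define c where "c = 1 / (4 * (of_int B + 1) :: real)"
  have c: "0 < c" unfolding c_def using B0 by simp
  have Y_pos: "0 < y" "y < 1" if y: "y \<in> Y" for y
  proof -
    obtain n where n: "y = frac (complete_quotient \<alpha> n)"
      using y unfolding Y_def by auto
    have "complete_quotient \<alpha> n \<notin> \<int>"
      using complete_quotient_irrational[OF assms(3), of n] Ints_subset_Rats by blast
    then show "0 < y" "y < 1"
      unfolding n by (auto simp: frac_lt_1)
  qed
  have Y_gauss: "frac (1 / y) \<in> Y" if y: "y \<in> Y" for y
  proof -
    obtain n where n: "y = frac (complete_quotient \<alpha> n)"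
      using y unfolding Y_def by auto
    then have "frac (1 / y) = frac (complete_quotient \<alpha> (Suc n))"
      by simp
    then show ?thesis unfolding Y_def by blast
  qed
  have Y_lower4: "4 * c \<le> y" if y: "y \<in> Y" for y
  proof -
    obtain n where n: "y = frac (complete_quotient \<alpha> n)"
      using y unfolding Y_def by auto
    then have "\<lfloor>1 / y\<rfloor> \<le> B"
      using B[of "Suc n"] unfolding partial_quotient_def by simp
    then have "1 / y \<le> of_int B + 1" by linarith
    then show ?thesis
      using Y_pos[OF y] B0 unfolding c_def by (simp add: field_simps)
  qed
  have Y_lower: "2 * c \<le> y" if "y \<in> Y" for y
    using Y_lower4[OF that] c by linarith
  \<comment> \<open>A point near 1 has a Gauss image near 0, which the lower bound forbids:
    \<open>1 / y \<ge> 1 + 4 * c\<close>.\<close>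
  have Y_upper: "y \<le> 1 - 2 * c" if y: "y \<in> Y" for y
  proof -
    let ?z = "frac (1 / y)"
    have z: "4 * c \<le> ?z" using Y_lower4[OF Y_gauss[OF y]] .
    have "1 \<le> \<lfloor>1 / y\<rfloor>" using Y_pos[OF y] by simp
    then have "1 + ?z \<le> 1 / y" unfolding frac_def by linarith
    then have "y * (1 + ?z) \<le> 1"
      using Y_pos[OF y] by (simp add: field_simps)
    moreover have "y * (1 + 4 * c) \<le> y * (1 + ?z)"
      using z Y_pos[OF y] by simp
    ultimately have 1: "y + y * 4 * c \<le> 1" by (simp add: algebra_simps)
    show ?thesis
    proof (cases "y \<le> 1 / 2")
      case True
      have "4 * c \<le> 1" unfolding c_def using B0 by simp
      then show ?thesis using True by linarith
    next
      case False
      then have "1 / 2 * (4 * c) \<le> y * (4 * c)"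
        using c by (intro mult_right_mono) auto
      then show ?thesis using 1 unfolding mult.assoc by linarith
    qed
  qed
  have \<alpha>Y: "\<alpha> \<in> Y"
    unfolding Y_def using assms(1,2) by (intro range_eqI[of _ _ 0]) (simp add: frac_eq)
  show ?thesis
  proof (rule that[OF c])
    fix k :: nat and p :: int
    assume k: "0 < k"
    show "c \<le> real k * \<bar>real k * \<alpha> - of_int p\<bar>"
    proof (cases "0 \<le> p")
      case True
      have "c * (1 + \<alpha> * 0) \<le> \<bar>real k * \<alpha> - of_int p\<bar> * (real k + of_int p * 0)"
        by (rule badly_approximable_gauss_invariant[where Y = Y])
          (use c Y_lower Y_upper Y_gauss \<alpha>Y k True in auto)
      then show ?thesis by (simp add: mult.commute)
    next
      case False
      have "1 * \<alpha> \<le> real k * \<alpha>" by (rule mult_right_mono) (use k assms in auto)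
      then have "c \<le> \<bar>real k * \<alpha> - of_int p\<bar>"
        using False Y_lower4[OF \<alpha>Y] c of_int_le_iff[of p 0, where ?'a = real] by linarith
      then have "1 * c \<le> real k * \<bar>real k * \<alpha> - of_int p\<bar>"
        using c k by (intro mult_mono) auto
      then show ?thesis by simp
    qed
  qed
qed

text \<open>A Dirichlet approximation \<open>h / k\<close> of \<open>\<alpha>\<close> with
  \<open>k \<le> Q\<close> has \<open>k > c * Q\<close> by bad approximability. The first
  \<open>k\<close> orbit points are therefore close to a full set of multiples of
  \<open>1 / k\<close>, which meets every arc of length \<open>\<eta>\<close> once \<open>Q\<close>
  is of order \<open>1 / \<eta>\<close>.\<close>

lemma badly_approximable_covering:
  fixes \<alpha> c :: real
  assumes c: "0 < c" "\<And>k p. 0 < k \<Longrightarrow> c \<le> real k * \<bar>real k * \<alpha> - of_int p\<bar>"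
    and \<eta>: "0 < \<eta>" "\<eta> \<le> 1"
  obtains n :: nat and z :: int
  where "real n \<le> (3 + 1 / c) / \<eta>" "s \<le> x + real n * \<alpha> - of_int z" "x + real n * \<alpha> - of_int z < s + \<eta>"
proof -
  \<comment> \<open>The spacing \<open>1 / k < 1 / (c * Q)\<close> plus an error
    \<open>1 / Q\<close> on either side must stay below \<open>\<eta>\<close>. Rounding up turns the
    2 into a 3, as \<open>\<eta> \<le> 1\<close>.\<close>
  define Q where "Q = nat \<lceil>(2 + 1 / c) / \<eta>\<rceil>"
  have Q: "(2 + 1 / c) / \<eta> \<le> real Q"
    unfolding Q_def by linarith
  have q_pos: "0 < (2 + 1 / c) / \<eta>" using c \<eta> by (simp add: add_pos_pos)
  then have Q0: "0 < Q" using Q by (simp add: Q_def)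
  have Q_upper: "real Q \<le> (3 + 1 / c) / \<eta>"
  proof -
    have "real Q \<le> (2 + 1 / c) / \<eta> + 1" unfolding Q_def using q_pos by linarith
    also have "\<dots> \<le> (2 + 1 / c) / \<eta> + 1 / \<eta>" using \<eta> by simp
    also have "\<dots> = (3 + 1 / c) / \<eta>" by (simp add: add_divide_distrib[symmetric])
    finally show ?thesis .
  qed
  obtain h k' where hk: "coprime h k'" "0 < k'" "k' \<le> int Q" "\<bar>of_int k' * \<alpha> - of_int h\<bar> < 1 / Q"
    using Dirichlet_approx_coprime[OF Q0] by metis
  define k where "k = nat k'"
  have k': "k' = int k" and k0: "0 < k" and kQ: "k \<le> Q"
    using hk unfolding k_def by auto
  define \<epsilon> where "\<epsilon> = real k * \<alpha> - of_int h"
  have \<epsilon>: "\<bar>\<epsilon>\<bar> < 1 / Q" using hk unfolding \<epsilon>_def k' by simp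
  have "c \<le> real k * \<bar>\<epsilon>\<bar>" using c(2)[OF k0] unfolding \<epsilon>_def .
  also have "\<dots> < real k * (1 / Q)"
    by (rule mult_strict_left_mono) (use \<epsilon> k0 in auto)
  finally have "1 / real k < 1 / (c * Q)"
    using c k0 Q0 by (simp add: field_simps)
  moreover have "(2 + 1 / c) / Q = 2 / Q + 1 / (c * Q)"
    by (simp add: add_divide_distrib)
  ultimately have "1 / real k + 2 / Q < (2 + 1 / c) / Q" by linarith
  also have "\<dots> \<le> \<eta>" using Q \<eta> Q0 by (simp add: field_simps)
  finally have size: "1 / real k + 2 / Q < \<eta>" .
  \<comment> \<open>The offset \<open>1 / Q\<close> leaves room for the approximation error at the
    left end; \<open>j / k\<close> is the first multiple of \<open>1 / k\<close> from
    \<open>t\<close> on.\<close>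
  define t where "t = s + 1 / Q - x"
  define j where "j = \<lceil>t * k\<rceil>"
  have "t * k \<le> j" "j < t * k + 1" unfolding j_def by linarith+
  then have j: "t \<le> j / k" "j / k < t + 1 / k"
    using k0 by (simp_all add: field_simps)
  \<comment> \<open>\<open>u\<close> inverts \<open>h\<close> modulo \<open>k\<close>, so
    \<open>n = u * j mod k\<close> is the time with \<open>h * n\<close> congruent to
    \<open>j\<close>.\<close>
  obtain u w where uw: "u * h + w * int k = 1"
    using bezout_int[of h "int k"] hk(1) unfolding k' by (auto simp: coprime_iff_gcd_eq_1)
  define n where "n = nat (u * j mod int k)"
  define z where "z = - (w * j) - h * (u * j div int k)"
  have n: "int n = u * j mod int k" "n < k"
    using k0 by (auto simp: n_def nat_less_iff)
  have "h * int n = h * (u * j) - h * (int k * (u * j div int k))"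
    unfolding n(1) minus_mult_div_eq_mod[symmetric] by (simp add: right_diff_distrib)
  also have "\<dots> = (1 - w * int k) * j - int k * (h * (u * j div int k))"
  proof -
    have "u * h = 1 - w * int k" using uw by simp
    then show ?thesis by (simp add: mult_ac)
  qed
  finally have z: "h * int n - j = int k * z"
    by (simp add: z_def algebra_simps)
  have "real n * \<alpha> = (of_int (h * int n) + real n * \<epsilon>) / k"
    unfolding \<epsilon>_def using k0 by (simp add: field_simps)
  also have "of_int (h * int n) = of_int (int k * z) + (of_int j :: real)"
    using z by linarith
  also have "(of_int (int k * z) + of_int j + real n * \<epsilon>) / k = of_int z + j / k + real n / k * \<epsilon>"
    using k0 by (simp add: field_simps)
  finally have eq: "x + real n * \<alpha> - of_int z = x + j / k + real n / k * \<epsilon>" by simp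
  have "real n / k * \<bar>\<epsilon>\<bar> \<le> 1 * \<bar>\<epsilon>\<bar>"
    by (rule mult_right_mono) (use n in auto)
  then have E: "\<bar>real n / k * \<epsilon>\<bar> < 1 / Q"
    using \<epsilon> by (simp add: abs_mult)
  have arith: "s \<le> x + J + E \<and> x + J + E < s + \<eta>"
    if "\<bar>E\<bar> < A" "s + A - x \<le> J" "J < s + A - x + D" "D + 2 * A < \<eta>" for A D E J :: real
    using that by linarith
  have "s \<le> x + real n * \<alpha> - of_int z" "x + real n * \<alpha> - of_int z < s + \<eta>"
    unfolding eq using arith[OF E j[unfolded t_def]] size by simp_all
  moreover have "real n \<le> (3 + 1 / c) / \<eta>"
    using n(2) kQ Q_upper by linarith
  ultimately show ?thesis using that by blast
qed

section \<open>Codings of two orbits of a rotation\<close>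

text \<open>The argument is a real lift of a point of the circle, so that orbits are plain
  arithmetic progressions \<open>x + n * \<alpha>\<close>.\<close>

definition rotation_side :: "real \<Rightarrow> real \<Rightarrow> side" where
  "rotation_side \<alpha> t = (if frac t < 1 - \<alpha> then L else R)"

lemma rotation_side_eq:
  assumes "t - of_int z = y" "0 \<le> y" "y < 1"
  shows "rotation_side \<alpha> t = (if y < 1 - \<alpha> then L else R)"
proof -
  have "frac t = y" using assms by (auto simp: frac_unique_iff)
  then show ?thesis by (simp add: rotation_side_def)
qed

text \<open>The two arcs on which the codings of \<open>t\<close> and \<open>t + \<delta>\<close> disagree are mapped to each other by
  the rotation: the first one is left through the discontinuity \<open>1 - \<alpha>\<close>, the second one through \<open>0\<close>.\<close>

lemma rotation_side_disagree_iff: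
  assumes "0 < \<delta>" "\<delta> \<le> \<alpha>" "\<delta> \<le> 1 - \<alpha>"
  shows "rotation_side \<alpha> t \<noteq> rotation_side \<alpha> (t + \<delta>) \<longleftrightarrow>
    1 - \<alpha> - \<delta> \<le> frac t \<and> frac t < 1 - \<alpha> \<or> 1 - \<delta> \<le> frac t"
  using assms frac_ge_0[of t] frac_lt_1[of t]
  unfolding rotation_side_def frac_add[of t \<delta>]
  by (auto simp: frac_eq[THEN iffD2])

text \<open>A first disagreement must lie in the arc ending at \<open>1 - \<alpha>\<close>, where
  the sides are \<open>L\<close> and \<open>R\<close>. One step later the two points straddle 0 and
  read \<open>R\<close> and \<open>L\<close>.\<close>

lemma rotation_side_exchange:
  assumes "0 < \<delta>" "\<delta> \<le> \<alpha>" "\<delta> \<le> 1 - \<alpha>"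
    and agree: "rotation_side \<alpha> t = rotation_side \<alpha> (t + \<delta>)"
    and disagree: "rotation_side \<alpha> (t + \<alpha>) \<noteq> rotation_side \<alpha> (t + \<alpha> + \<delta>)"
  shows "1 - \<alpha> - \<delta> \<le> frac (t + \<alpha>)" "frac (t + \<alpha>) < 1 - \<alpha>"
    and "1 - \<delta> \<le> frac (t + \<alpha> + \<alpha>)"
    and "rotation_side \<alpha> (t + \<alpha> + \<alpha>) = rotation_side \<alpha> (t + \<alpha> + \<delta>)"
    and "rotation_side \<alpha> (t + \<alpha> + \<delta> + \<alpha>) = rotation_side \<alpha> (t + \<alpha>)"
proof -
  have \<alpha>: "0 < \<alpha>" "\<alpha> < 1" "\<delta> < 1" using assms by linarith+
  \<comment> \<open>One step before the arc ending at 1 the orbit is in the arc ending at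
    \<open>1 - \<alpha>\<close>, where the sides already disagree.\<close>
  have "\<not> 1 - \<delta> \<le> frac (t + \<alpha>)"
  proof
    assume *: "1 - \<delta> \<le> frac (t + \<alpha>)"
    have "t - (frac (t + \<alpha>) - \<alpha>) = of_int \<lfloor>t + \<alpha>\<rfloor>" by (simp add: frac_def)
    then have "frac t = frac (t + \<alpha>) - \<alpha>"
      using * assms(3) frac_lt_1[of "t + \<alpha>"] \<alpha> by (auto simp: frac_unique_iff)
    then have "rotation_side \<alpha> t \<noteq> rotation_side \<alpha> (t + \<delta>)"
      unfolding rotation_side_disagree_iff[OF assms(1-3)]
      using * frac_lt_1[of "t + \<alpha>"] by auto
    then show False using agree by simp
  qed
  then show y: "1 - \<alpha> - \<delta> \<le> frac (t + \<alpha>)" "frac (t + \<alpha>) < 1 - \<alpha>"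
    using disagree unfolding rotation_side_disagree_iff[OF assms(1-3)] by auto
  define y where "y = frac (t + \<alpha>)"
  define z where "z = \<lfloor>t + \<alpha>\<rfloor>"
  have t: "t + \<alpha> = y + of_int z" by (simp add: y_def z_def frac_def)
  have y': "1 - \<alpha> - \<delta> \<le> y" "y < 1 - \<alpha>" using y by (auto simp: y_def)
  have "frac (t + \<alpha> + \<alpha>) = y + \<alpha>"
    using y' \<alpha> assms unfolding frac_unique_iff t by auto
  then show "1 - \<delta> \<le> frac (t + \<alpha> + \<alpha>)" using y' by simp
  have 1: "rotation_side \<alpha> (t + \<alpha>) = L"
    using y by (simp add: rotation_side_def)
  have 2: "rotation_side \<alpha> (t + \<alpha> + \<delta>) = R"
    using 1 disagree by (metis side.exhaust)
  have 3: "rotation_side \<alpha> (t + \<alpha> + \<alpha>) = R"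
    using rotation_side_eq[of "t + \<alpha> + \<alpha>" z "y + \<alpha>" \<alpha>] y' \<alpha> assms(1-3) unfolding t by auto
  have 4: "rotation_side \<alpha> (t + \<alpha> + \<delta> + \<alpha>) = L"
    using rotation_side_eq[of "t + \<alpha> + \<delta> + \<alpha>" "z + 1" "y + \<delta> + \<alpha> - 1" \<alpha>] y' \<alpha> assms(1-3) unfolding t by auto
  show "rotation_side \<alpha> (t + \<alpha> + \<alpha>) = rotation_side \<alpha> (t + \<alpha> + \<delta>)"
    "rotation_side \<alpha> (t + \<alpha> + \<delta> + \<alpha>) = rotation_side \<alpha> (t + \<alpha>)"
    using 1 2 3 4 by simp_all
qed

lemma rotation_side_disagree_recurrent:
  assumes \<alpha>: "0 < \<alpha>" "\<alpha> < 1"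
    and c: "0 < c" "\<And>k p. 0 < k \<Longrightarrow> c \<le> real k * \<bar>real k * \<alpha> - of_int p\<bar>"
    and \<delta>: "0 < \<delta>" "\<delta> \<le> 1 / 2"
  obtains n :: nat
  where "real n \<le> (3 + 1 / c) / min \<alpha> (1 - \<alpha>) * (1 / \<delta>)"
    "rotation_side \<alpha> (x + real n * \<alpha>) \<noteq> rotation_side \<alpha> (x + \<delta> + real n * \<alpha>)"
proof -
  define \<eta> where "\<eta> = \<delta> * min \<alpha> (1 - \<alpha>)"
  have \<eta>: "0 < \<eta>" "\<eta> \<le> \<delta>" "\<eta> \<le> min \<alpha> (1 - \<alpha>)"
    unfolding \<eta>_def using \<alpha> \<delta> mult_left_le_one_le[of "min \<alpha> (1 - \<alpha>)" \<delta>]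
    by (auto intro: mult_left_le simp del: min_less_iff_conj min.bounded_iff)
  then have \<eta>1: "\<eta> \<le> 1" using \<delta> by linarith
  \<comment> \<open>The arc ends at the discontinuity that can be crossed without meeting the other
    one: for \<open>\<delta> > 1 - \<alpha>\<close> the bound \<open>\<delta> \<le> 1 / 2\<close>
    gives \<open>\<delta> < \<alpha>\<close>, so crossing \<open>1 - \<alpha>\<close> is
    safe.\<close>
  define s where "s = (if \<delta> \<le> 1 - \<alpha> then 1 - \<eta> else 1 - \<alpha> - \<eta>)"
  obtain n :: nat and z where n: "real n \<le> (3 + 1 / c) / \<eta>"
      "s \<le> x + real n * \<alpha> - of_int z" "x + real n * \<alpha> - of_int z < s + \<eta>"
    using badly_approximable_covering[OF c \<eta>(1) \<eta>1] by blast
  define y where "y = x + real n * \<alpha> - of_int z"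
  have "rotation_side \<alpha> (x + real n * \<alpha>) \<noteq> rotation_side \<alpha> (x + \<delta> + real n * \<alpha>)"
  proof (cases "\<delta> \<le> 1 - \<alpha>")
    case True
    have "1 - \<eta> \<le> y" "y < 1" using n True by (auto simp: s_def y_def)
    then show ?thesis
      using rotation_side_eq[of "x + real n * \<alpha>" z y \<alpha>]
        rotation_side_eq[of "x + \<delta> + real n * \<alpha>" "z + 1" "y + \<delta> - 1" \<alpha>] True \<eta> \<eta>1 \<delta>
      by (auto simp: y_def)
  next
    case False
    have "1 - \<alpha> - \<eta> \<le> y" "y < 1 - \<alpha>" using n False by (auto simp: s_def y_def)
    then show ?thesis
      using rotation_side_eq[of "x + real n * \<alpha>" z y \<alpha>]
        rotation_side_eq[of "x + \<delta> + real n * \<alpha>" z "y + \<delta>" \<alpha>] False \<eta> \<eta>1 \<delta> \<alpha>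
      by (auto simp: y_def)
  qed
  moreover have "real n \<le> (3 + 1 / c) / min \<alpha> (1 - \<alpha>) * (1 / \<delta>)"
    using n(1) unfolding \<eta>_def by (simp add: mult.commute)
  ultimately show ?thesis using that by blast
qed

text \<open>Two visits to the same arc of length \<open>\<delta>\<close> at times differing by
  \<open>l\<close> put \<open>l * \<alpha>\<close> within \<open>\<delta>\<close> of an integer, so
  \<open>l \<ge> c / \<delta>\<close>.\<close>

lemma rotation_side_disagree_separated:
  assumes c: "\<And>k p. 0 < k \<Longrightarrow> c \<le> real k * \<bar>real k * \<alpha> - of_int p\<bar>"
    and \<delta>: "0 < \<delta>" "\<delta> \<le> \<alpha>" "\<delta> \<le> 1 - \<alpha>"
    and t: "1 - \<alpha> - \<delta> \<le> frac t" "frac t < 1 - \<alpha>" "1 - \<delta> \<le> frac (t + \<alpha>)"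
    and "2 \<le> k"
    and disagree: "rotation_side \<alpha> (t + real k * \<alpha>) \<noteq> rotation_side \<alpha> (t + \<delta> + real k * \<alpha>)"
  shows "c * (1 / \<delta>) \<le> real k"
proof -
  have near: "c * (1 / \<delta>) \<le> real l" if "0 < l" "\<bar>frac (s + real l * \<alpha>) - frac s\<bar> < \<delta>" for s l
  proof -
    have eq: "real l * \<alpha> - of_int (\<lfloor>s + real l * \<alpha>\<rfloor> - \<lfloor>s\<rfloor>) = frac (s + real l * \<alpha>) - frac s"
      by (simp add: frac_def)
    have "c \<le> real l * \<bar>frac (s + real l * \<alpha>) - frac s\<bar>"
      using c[OF that(1), of "\<lfloor>s + real l * \<alpha>\<rfloor> - \<lfloor>s\<rfloor>"] unfolding eq .
    also have "\<dots> \<le> real l * \<delta>"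
      using that by (intro mult_left_mono) auto
    finally show ?thesis using \<delta> by (simp add: field_simps)
  qed
  have "t + \<delta> + real k * \<alpha> = t + real k * \<alpha> + \<delta>" by simp
  then consider "1 - \<alpha> - \<delta> \<le> frac (t + real k * \<alpha>)" "frac (t + real k * \<alpha>) < 1 - \<alpha>"
    | "1 - \<delta> \<le> frac (t + real k * \<alpha>)"
    using disagree rotation_side_disagree_iff[OF \<delta>, of "t + real k * \<alpha>"] by metis
  then show ?thesis
  proof cases
    case 1
    then show ?thesis using near[of k t] t \<open>2 \<le> k\<close> by auto
  next
    case 2
    \<comment> \<open>A visit to the second arc is compared with the second half of the exchange, at
      time 1; \<open>2 \<le> k\<close> makes the difference positive.\<close>
    have eq: "t + \<alpha> + real (k - 1) * \<alpha> = t + real k * \<alpha>"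
      using \<open>2 \<le> k\<close> by (simp add: of_nat_diff algebra_simps)
    have "\<bar>frac (t + \<alpha> + real (k - 1) * \<alpha>) - frac (t + \<alpha>)\<bar> < \<delta>"
      unfolding eq using 2 t(3) frac_lt_1[of "t + \<alpha>"] frac_lt_1[of "t + real k * \<alpha>"] by linarith
    then have "c * (1 / \<delta>) \<le> real (k - 1)"
      using \<open>2 \<le> k\<close> by (intro near) auto
    then show ?thesis by linarith
  qed
qed

section \<open>Gaps between the exchanges of two codings\<close>

text \<open>The parameter \<open>\<rho>\<close> is the inverse of the distance \<open>\<delta>\<close> of the two points on the circle. The
  alternative \<open>c * \<rho> \<le> 1\<close> covers distances that are too large for the disagreements to come in
  pairs \<open>LR\<close> / \<open>RL\<close>.\<close>

definition exchange_pattern :: "real \<Rightarrow> real \<Rightarrow> real \<Rightarrow> (nat \<Rightarrow> side) \<Rightarrow> (nat \<Rightarrow> side) \<Rightarrow> bool" where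
  "exchange_pattern K c \<rho> s s' \<longleftrightarrow>
    (\<forall>N. \<exists>n\<ge>N. real (n - N) \<le> K * \<rho> \<and> s n \<noteq> s' n) \<and>
    (\<forall>m. s m = s' m \<and> s (Suc m) \<noteq> s' (Suc m) \<longrightarrow>
       c * \<rho> \<le> 1 \<or>
       s (m + 2) = s' (Suc m) \<and> s' (m + 2) = s (Suc m) \<and>
       (\<forall>n\<ge>m + 3. s n \<noteq> s' n \<longrightarrow> c * \<rho> \<le> real (n - Suc m)))"

lemma exchange_pattern_sym:
  assumes "exchange_pattern K c \<rho> s s'"
  shows "exchange_pattern K c \<rho> s' s"
  unfolding exchange_pattern_def
proof (intro conjI allI)
  show "\<exists>n\<ge>N. real (n - N) \<le> K * \<rho> \<and> s' n \<noteq> s n" for N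
    using assms unfolding exchange_pattern_def by metis
  have "s m = s' m \<and> s (Suc m) \<noteq> s' (Suc m) \<longrightarrow>
       c * \<rho> \<le> 1 \<or>
       s (m + 2) = s' (Suc m) \<and> s' (m + 2) = s (Suc m) \<and>
       (\<forall>n\<ge>m + 3. s n \<noteq> s' n \<longrightarrow> c * \<rho> \<le> real (n - Suc m))" for m
    using assms unfolding exchange_pattern_def by blast
  then show "s' m = s m \<and> s' (Suc m) \<noteq> s (Suc m) \<longrightarrow>
       c * \<rho> \<le> 1 \<or>
       s' (m + 2) = s (Suc m) \<and> s (m + 2) = s' (Suc m) \<and>
       (\<forall>n\<ge>m + 3. s' n \<noteq> s n \<longrightarrow> c * \<rho> \<le> real (n - Suc m))" for m
    by metis
qed

lemma exchange_pattern_mono: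
  assumes "2 \<le> \<rho>" "exchange_pattern K c \<rho> s s'" "c' \<le> c"
  shows "exchange_pattern K c' \<rho> s s'"
proof -
  have "c' * \<rho> \<le> c * \<rho>" using assms by (intro mult_right_mono) auto
  then show ?thesis using assms(2) unfolding exchange_pattern_def by (meson order_trans)
qed

lemma exchange_pattern_rotation_side:
  assumes \<alpha>: "0 < \<alpha>" "\<alpha> < 1"
    and c: "0 < c" "\<And>k p. 0 < k \<Longrightarrow> c \<le> real k * \<bar>real k * \<alpha> - of_int p\<bar>"
    and \<delta>: "0 < \<delta>" "\<delta> \<le> 1 / 2"
  shows "exchange_pattern ((3 + 1 / c) / min \<alpha> (1 - \<alpha>)) (min c (min \<alpha> (1 - \<alpha>))) (1 / \<delta>)
    (\<lambda>n. rotation_side \<alpha> (x + real n * \<alpha>)) (\<lambda>n. rotation_side \<alpha> (x + \<delta> + real n * \<alpha>))"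
  unfolding exchange_pattern_def
proof (intro conjI allI impI)
  fix N :: nat
  obtain n where n: "real n \<le> (3 + 1 / c) / min \<alpha> (1 - \<alpha>) * (1 / \<delta>)"
    "rotation_side \<alpha> (x + real N * \<alpha> + real n * \<alpha>) \<noteq> rotation_side \<alpha> (x + real N * \<alpha> + \<delta> + real n * \<alpha>)"
    using rotation_side_disagree_recurrent[OF \<alpha> c \<delta>] by blast
  have shift: "x + real N * \<alpha> + real n * \<alpha> = x + real (N + n) * \<alpha>"
    "x + real N * \<alpha> + \<delta> + real n * \<alpha> = x + \<delta> + real (N + n) * \<alpha>"
    by (simp_all add: algebra_simps)
  show "\<exists>n\<ge>N. real (n - N) \<le> (3 + 1 / c) / min \<alpha> (1 - \<alpha>) * (1 / \<delta>) \<and>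
      rotation_side \<alpha> (x + real n * \<alpha>) \<noteq> rotation_side \<alpha> (x + \<delta> + real n * \<alpha>)"
    using n(1) n(2)[unfolded shift] by (metis diff_add_inverse le_add1)
next
  fix m
  assume *: "rotation_side \<alpha> (x + real m * \<alpha>) = rotation_side \<alpha> (x + \<delta> + real m * \<alpha>) \<and>
    rotation_side \<alpha> (x + real (Suc m) * \<alpha>) \<noteq> rotation_side \<alpha> (x + \<delta> + real (Suc m) * \<alpha>)"
  show "min c (min \<alpha> (1 - \<alpha>)) * (1 / \<delta>) \<le> 1 \<or>
    rotation_side \<alpha> (x + real (m + 2) * \<alpha>) = rotation_side \<alpha> (x + \<delta> + real (Suc m) * \<alpha>) \<and>
    rotation_side \<alpha> (x + \<delta> + real (m + 2) * \<alpha>) = rotation_side \<alpha> (x + real (Suc m) * \<alpha>) \<and>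
    (\<forall>n\<ge>m + 3. rotation_side \<alpha> (x + real n * \<alpha>) \<noteq> rotation_side \<alpha> (x + \<delta> + real n * \<alpha>) \<longrightarrow>
       min c (min \<alpha> (1 - \<alpha>)) * (1 / \<delta>) \<le> real (n - Suc m))"
  proof (cases "min c (min \<alpha> (1 - \<alpha>)) * (1 / \<delta>) \<le> 1")
    case False
    \<comment> \<open>This is why \<open>\<alpha>\<close> and \<open>1 - \<alpha>\<close> enter the
      minimum: beyond the alternative \<open>c * \<rho> \<le> 1\<close>, the arcs are short enough
      for the exchange lemma.\<close>
    then have \<delta>': "\<delta> \<le> \<alpha>" "\<delta> \<le> 1 - \<alpha>"
      using \<delta> by (auto simp: field_simps)
    define t where "t = x + real m * \<alpha>"
    have t: "x + real m * \<alpha> = t" "x + \<delta> + real m * \<alpha> = t + \<delta>"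
      "x + real (Suc m) * \<alpha> = t + \<alpha>" "x + \<delta> + real (Suc m) * \<alpha> = t + \<alpha> + \<delta>"
      "x + real (m + 2) * \<alpha> = t + \<alpha> + \<alpha>" "x + \<delta> + real (m + 2) * \<alpha> = t + \<alpha> + \<delta> + \<alpha>"
      by (simp_all add: t_def algebra_simps)
    have "rotation_side \<alpha> t = rotation_side \<alpha> (t + \<delta>)"
      "rotation_side \<alpha> (t + \<alpha>) \<noteq> rotation_side \<alpha> (t + \<alpha> + \<delta>)"
      using * unfolding t by auto
    note ex = rotation_side_exchange[OF \<delta>(1) \<delta>' this]
    have "min c (min \<alpha> (1 - \<alpha>)) * (1 / \<delta>) \<le> real (n - Suc m)"
      if n: "m + 3 \<le> n" "rotation_side \<alpha> (x + real n * \<alpha>) \<noteq> rotation_side \<alpha> (x + \<delta> + real n * \<alpha>)" for n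
    proof -
      have shift: "x + real n * \<alpha> = t + \<alpha> + real (n - Suc m) * \<alpha>"
        "x + \<delta> + real n * \<alpha> = t + \<alpha> + \<delta> + real (n - Suc m) * \<alpha>"
        using n(1) by (simp_all add: t_def of_nat_diff algebra_simps)
      have "c * (1 / \<delta>) \<le> real (n - Suc m)"
        by (rule rotation_side_disagree_separated[OF c(2) \<delta>(1) \<delta>' ex(1-3)])
          (use n(1) n(2)[unfolded shift] in simp_all)
      moreover have "min c (min \<alpha> (1 - \<alpha>)) * (1 / \<delta>) \<le> c * (1 / \<delta>)"
        using \<delta> by (intro mult_right_mono) auto
      ultimately show ?thesis by linarith
    qed
    then show ?thesis using ex(4,5) unfolding t by blast
  qed simp
qed

text \<open>\<open>K\<close> and \<open>c\<close> depend on \<open>\<alpha>\<close> alone. Two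
  points of the circle are at distance at most \<open>1 / 2\<close> in one of the two directions,
  and the pattern is symmetric in the codings; distance 0 gives equal codings.\<close>

lemma rotation_side_dichotomy:
  assumes \<alpha>: "0 < \<alpha>" "\<alpha> < 1" "\<alpha> \<notin> \<rat>" "bounded_partial_quotients \<alpha>"
  obtains K c where "0 < K" "0 < c"
    "\<And>x x'. (\<forall>n. rotation_side \<alpha> (x + real n * \<alpha>) = rotation_side \<alpha> (x' + real n * \<alpha>)) \<or>
      (\<exists>\<rho>\<ge>2. exchange_pattern K c \<rho> (\<lambda>n. rotation_side \<alpha> (x + real n * \<alpha>))
        (\<lambda>n. rotation_side \<alpha> (x' + real n * \<alpha>)))"
proof -
  obtain c where c: "0 < c" "\<And>k p. 0 < k \<Longrightarrow> c \<le> real k * \<bar>real k * \<alpha> - of_int p\<bar>"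
    using badly_approximable_if_bounded_partial_quotients[OF \<alpha>] by blast
  let ?K = "(3 + 1 / c) / min \<alpha> (1 - \<alpha>)" and ?c = "min c (min \<alpha> (1 - \<alpha>))"
  have half: "(\<forall>n. rotation_side \<alpha> (x + real n * \<alpha>) = rotation_side \<alpha> (x' + real n * \<alpha>)) \<or>
      (\<exists>\<rho>\<ge>2. exchange_pattern ?K ?c \<rho> (\<lambda>n. rotation_side \<alpha> (x + real n * \<alpha>))
        (\<lambda>n. rotation_side \<alpha> (x' + real n * \<alpha>)))"
    if le: "frac (x' - x) \<le> 1 / 2" for x x'
  proof -
    define \<delta> where "\<delta> = frac (x' - x)"
    have shift: "rotation_side \<alpha> (x' + r) = rotation_side \<alpha> (x + \<delta> + r)" for r
    proof -
      have "x' + r = (x + \<delta> + r) + of_int \<lfloor>x' - x\<rfloor>" by (simp add: \<delta>_def frac_def)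
      then show ?thesis unfolding rotation_side_def by (metis frac_add_of_int_right)
    qed
    show ?thesis
    proof (cases "\<delta> = 0")
      case True
      then show ?thesis unfolding shift by simp
    next
      case False
      then have \<delta>: "0 < \<delta>" "\<delta> \<le> 1 / 2"
        using le frac_ge_0[of "x' - x"] by (auto simp: \<delta>_def)
      have "2 \<le> 1 / \<delta>" using \<delta> by (simp add: field_simps)
      then show ?thesis
        using exchange_pattern_rotation_side[OF \<alpha>(1,2) c \<delta>, of x] unfolding shift by blast
    qed
  qed
  have "(\<forall>n. rotation_side \<alpha> (x + real n * \<alpha>) = rotation_side \<alpha> (x' + real n * \<alpha>)) \<or>
      (\<exists>\<rho>\<ge>2. exchange_pattern ?K ?c \<rho> (\<lambda>n. rotation_side \<alpha> (x + real n * \<alpha>))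
        (\<lambda>n. rotation_side \<alpha> (x' + real n * \<alpha>)))" for x x'
  proof (cases "frac (x' - x) \<le> 1 / 2")
    case True
    then show ?thesis by (rule half)
  next
    case False
    then have "frac (x - x') \<le> 1 / 2"
      using frac_neg[of "x' - x"] by (auto split: if_splits)
    from half[OF this] show ?thesis
      using exchange_pattern_sym by fastforce
  qed
  moreover have "0 < ?K" "0 < ?c" using c \<alpha> by (auto intro!: divide_pos_pos add_pos_pos)
  ultimately show ?thesis using that by blast
qed

section \<open>Density of mismatches\<close>

lemma card_Int_blocks_ge:
  fixes \<beta> :: real
  assumes "\<And>a. a + M \<le> q \<Longrightarrow> \<beta> \<le> real (card (S \<inter> {a..<a + M}))" "k * M \<le> q"
  shows "real k * \<beta> \<le> real (card (S \<inter> {0..<k * M}))"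
  using assms(2)
proof (induction k)
  case (Suc k)
  have "S \<inter> {0..<Suc k * M} = (S \<inter> {0..<k * M}) \<union> (S \<inter> {k * M..<k * M + M})"
    by auto
  moreover have "card \<dots> = card (S \<inter> {0..<k * M}) + card (S \<inter> {k * M..<k * M + M})"
    by (rule card_Un_disjoint) auto
  moreover have "\<beta> \<le> real (card (S \<inter> {k * M..<k * M + M}))"
    using Suc.prems by (intro assms(1)) (simp add: add.commute)
  moreover have "real k * \<beta> \<le> real (card (S \<inter> {0..<k * M}))"
    using Suc by simp
  ultimately show ?case by (simp add: distrib_right)
qed simp

section \<open>Index sequences driven by side sequences\<close>

text \<open>A word is split into indices \<open>a i n\<close> and sides \<open>s n\<close>, the
  latter shared by all \<open>i\<close>. The step equations run backwards because the transformation
  applies the inverse permutations.\<close>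

locale coded_orbits =
  fixes d q e :: nat and P :: "side \<Rightarrow> nat \<Rightarrow> nat"
    and s s' :: "nat \<Rightarrow> side" and a b :: "nat \<Rightarrow> nat \<Rightarrow> nat"
  assumes permutes: "\<And>\<sigma>. P \<sigma> permutes {1..d}"
    and a_in: "\<And>i n. i \<in> {1..e} \<Longrightarrow> n < q \<Longrightarrow> a i n \<in> {1..d}"
    and a_step: "\<And>i n. i \<in> {1..e} \<Longrightarrow> Suc n < q \<Longrightarrow> P (s n) (a i (Suc n)) = a i n"
    and b_step: "\<And>i n. i \<in> {1..e} \<Longrightarrow> Suc n < q \<Longrightarrow> P (s' n) (b i (Suc n)) = b i n"
    and a_distinct: "\<And>i j. i \<in> {1..e} \<Longrightarrow> j \<in> {1..e} \<Longrightarrow> i \<noteq> j \<Longrightarrow> \<exists>n<q. a i n \<noteq> a j n"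
    and commuting: "1 + card {i \<in> {1..d}. P L (P R i) = P R (P L i)} \<le> e"
begin

definition good :: "nat set" where
  "good = {n. n < q \<and> s n = s' n \<and> (\<forall>i\<in>{1..e}. a i n = b i n)}"

lemma P_cancel: "P \<sigma> x = P \<sigma> y \<Longrightarrow> x = y"
  using permutes[of \<sigma>] by (metis permutes_inj injD)

text \<open>With a common side sequence, the index at one position determines the whole word:
  backwards by applying \<open>P\<close>, forwards by cancelling it.\<close>

lemma a_inj_on:
  assumes "n < q"
  shows "inj_on (\<lambda>i. a i n) {1..e}"
proof (rule inj_onI, rule ccontr)
  fix i j
  assume ij: "i \<in> {1..e}" "j \<in> {1..e}" "a i n = a j n" "i \<noteq> j"
  have down: "a i k = a j k" if "k \<le> n" for k
    using that
  proof (induction k rule: inc_induct)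
    case base
    show ?case by (rule ij)
  next
    case (step k)
    then have "Suc k < q" using assms by simp
    then show ?case
      using a_step[OF ij(1)] a_step[OF ij(2)] step by metis
  qed
  have up: "k < q \<longrightarrow> a i k = a j k" if "n \<le> k" for k
    using that
  proof (induction k rule: dec_induct)
    case base
    show ?case using ij by simp
  next
    case (step k)
    show ?case
    proof
      assume "Suc k < q"
      then have "P (s k) (a i (Suc k)) = P (s k) (a j (Suc k))"
        using a_step[OF ij(1)] a_step[OF ij(2)] step by simp
      then show "a i (Suc k) = a j (Suc k)" by (rule P_cancel)
    qed
  qed
  have "a i k = a j k" if "k < q" for k
    using down[of k] up[of k] that by (cases "k \<le> n") auto
  then show False using a_distinct[OF ij(1,2,4)] by blast
qed

lemma good_Suc:
  assumes "m \<in> good" "Suc m < q" "i \<in> {1..e}"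
  shows "a i (Suc m) = b i (Suc m)"
proof -
  have "P (s m) (a i (Suc m)) = P (s m) (b i (Suc m))"
    using assms a_step[OF assms(3,2)] b_step[OF assms(3,2)] by (simp add: good_def)
  then show ?thesis by (rule P_cancel)
qed

text \<open>If the two products of \<open>P L\<close> and \<open>P R\<close> led to the same index for every \<open>i\<close>, these indices
  would be \<open>e\<close> distinct points at which \<open>P L\<close> and \<open>P R\<close> commute.\<close>

lemma exchange_creates_mismatch:
  assumes "m + 3 < q" "s (Suc m) \<noteq> s' (Suc m)" "s (m + 2) = s' (Suc m)" "s' (m + 2) = s (Suc m)"
    and eq: "\<And>i. i \<in> {1..e} \<Longrightarrow> a i (Suc m) = b i (Suc m)"
  shows "\<exists>i\<in>{1..e}. a i (m + 3) \<noteq> b i (m + 3)"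
proof (rule ccontr)
  assume "\<not> ?thesis"
  then have all: "\<And>i. i \<in> {1..e} \<Longrightarrow> a i (m + 3) = b i (m + 3)" by blast
  have "P L (P R (a i (m + 3))) = P R (P L (a i (m + 3)))" if i: "i \<in> {1..e}" for i
  proof -
    have "P (s (Suc m)) (P (s (m + 2)) (a i (m + 3))) = a i (Suc m)"
      using a_step[OF i, of "Suc m"] a_step[OF i, of "m + 2"] assms(1) by (simp add: numeral_eq_Suc)
    moreover have "P (s' (Suc m)) (P (s' (m + 2)) (a i (m + 3))) = b i (Suc m)"
      using b_step[OF i, of "Suc m"] b_step[OF i, of "m + 2"] assms(1) all[OF i]
      by (simp add: numeral_eq_Suc)
    ultimately have "P (s (Suc m)) (P (s' (Suc m)) (a i (m + 3))) =
        P (s' (Suc m)) (P (s (Suc m)) (a i (m + 3)))"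
      using assms(3,4) eq[OF i] by simp
    then show ?thesis
      using assms(2) by (cases "s (Suc m)"; cases "s' (Suc m)") auto
  qed
  then have "(\<lambda>i. a i (m + 3)) ` {1..e} \<subseteq> {i \<in> {1..d}. P L (P R i) = P R (P L i)}"
    using a_in assms(1) by auto
  then have "card ((\<lambda>i. a i (m + 3)) ` {1..e}) \<le> card {i \<in> {1..d}. P L (P R i) = P R (P L i)}"
    by (rule card_mono[rotated]) simp
  then show False
    using card_image[OF a_inj_on[OF assms(1)]] commuting by simp
qed

lemma mismatch_persists:
  assumes "a i m \<noteq> b i m" "i \<in> {1..e}" "m \<le> n" "n < q" "\<And>k. m \<le> k \<Longrightarrow> k < n \<Longrightarrow> s k = s' k"
  shows "a i n \<noteq> b i n"
  using assms(3-5)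
proof (induction n rule: dec_induct)
  case base
  show ?case by (rule assms)
next
  case (step n)
  then have "P (s n) (a i (Suc n)) \<noteq> P (s n) (b i (Suc n))"
    using a_step[OF assms(2), of n] b_step[OF assms(2), of n] by simp
  then show ?case by auto
qed

text \<open>The bad stretch around \<open>h\<close> starts with a disagreement of sides, since
  indices still agree one step after a good position. The exchange then creates an index mismatch,
  which can be repaired only after the next disagreement, about \<open>c * \<rho>\<close>
  later.\<close>

lemma good_gap_long:
  assumes pat: "exchange_pattern K c \<rho> s s'"
    and "g < h" "h < g'" "g \<in> good" "h \<notin> good" "g' \<in> good"
  shows "c * \<rho> \<le> real (card ({g..<g'} - good))"
proof -
  define m where "m = Max (good \<inter> {g..h})"
  have fin: "finite (good \<inter> {g..h})" "good \<inter> {g..h} \<noteq> {}" using assms by auto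
  have m: "m \<in> good" "g \<le> m" "m \<le> h" using Max_in[OF fin] by (auto simp: m_def)
  have m_max: "k \<notin> good" if "m < k" "k \<le> h" for k
    using Max_ge[OF fin(1), of k] that m by (auto simp flip: m_def)
  have "m < h" using m assms by (metis le_neq_implies_less)
  define r where "r = Min (good \<inter> {h..g'})"
  have fin': "finite (good \<inter> {h..g'})" "good \<inter> {h..g'} \<noteq> {}" using assms by auto
  have r: "r \<in> good" "h \<le> r" "r \<le> g'" using Min_in[OF fin'] by (auto simp: r_def)
  have r_min: "k \<notin> good" if "k < r" "h \<le> k" for k
    using Min_le[OF fin'(1), of k] that r by (auto simp flip: r_def)
  have "h < r" using r assms by (metis le_neq_implies_less)
  have bad: "k \<notin> good" if "m < k" "k < r" for k
    using m_max r_min that by (metis nat_le_linear)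
  have rq: "r < q" using r by (simp add: good_def)
  have "{Suc m..<r} \<subseteq> {g..<g'} - good" using bad m r by auto
  then have card: "card {Suc m..<r} \<le> card ({g..<g'} - good)" by (rule card_mono[rotated]) simp
  have ab: "a i (Suc m) = b i (Suc m)" if "i \<in> {1..e}" for i
    using good_Suc[OF m(1) _ that] \<open>m < h\<close> \<open>h < r\<close> rq by simp
  have ss: "s m = s' m" "s (Suc m) \<noteq> s' (Suc m)"
    using m(1) bad[of "Suc m"] ab \<open>m < h\<close> \<open>h < r\<close> rq by (auto simp: good_def)
  then consider "c * \<rho> \<le> 1" | "s (m + 2) = s' (Suc m)" "s' (m + 2) = s (Suc m)"
      "\<And>n. m + 3 \<le> n \<Longrightarrow> s n \<noteq> s' n \<Longrightarrow> c * \<rho> \<le> real (n - Suc m)"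
    using pat unfolding exchange_pattern_def by blast
  then have "c * \<rho> \<le> real (r - Suc m)"
  proof cases
    \<comment> \<open>A single bad position is enough here.\<close>
    case 1
    have "1 \<le> r - Suc m" using \<open>m < h\<close> \<open>h < r\<close> by simp
    then show ?thesis using 1 by linarith
  next
    case 2
    have "r \<noteq> m + 2" using 2(1,2) ss(2) r(1) by (auto simp: good_def)
    then have r3: "m + 3 \<le> r" using \<open>m < h\<close> \<open>h < r\<close> by linarith
    obtain i where i: "i \<in> {1..e}" "a i (m + 3) \<noteq> b i (m + 3)"
    proof (cases "m + 3 < q")
      case True
      then show ?thesis using exchange_creates_mismatch[OF True ss(2) 2(1,2) ab] that by blast
    qed (use r3 rq in simp)
    \<comment> \<open>Without such a disagreement the mismatch would persist up to the good position
      \<open>r\<close>.\<close>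
    have "\<exists>n\<ge>m + 3. n < r \<and> s n \<noteq> s' n"
      using mismatch_persists[OF i(2,1) r3 rq] r(1) i(1) by (auto simp: good_def)
    then obtain n where n: "m + 3 \<le> n" "n < r" "s n \<noteq> s' n" by blast
    then have "c * \<rho> \<le> real (n - Suc m)" by (intro 2(3))
    also have "\<dots> \<le> real (r - Suc m)" using n by simp
    finally show ?thesis .
  qed
  then show ?thesis using card by simp
qed

text \<open>Sides must disagree within \<open>K * \<rho>\<close> steps of \<open>g\<close>, and such
  a position is never good.\<close>

lemma good_run_short:
  assumes pat: "exchange_pattern K c \<rho> s s'" and run: "{g..g'} \<subseteq> good"
  shows "real g' \<le> real g + K * \<rho> \<or> g' < g"
proof (rule disjCI)
  assume "\<not> g' < g"
  obtain n where n: "g \<le> n" "real (n - g) \<le> K * \<rho>" "s n \<noteq> s' n"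
    using pat unfolding exchange_pattern_def by blast
  have "g' < n"
    using run n(1,3) by (force simp: good_def)
  then show "real g' \<le> real g + K * \<rho>" using n(1,2) by simp
qed

text \<open>Either a bad position lies between two good ones of the window, and the gap bound
  applies, or the good positions form a single run of length at most \<open>W\<close>. Then the
  other half of the window is bad, and \<open>W \<ge> K * \<rho> \<ge> c * \<rho>\<close>.\<close>

lemma bad_in_window:
  assumes pat: "exchange_pattern K c \<rho> s s'" and "2 \<le> \<rho>"
    and W: "W = nat \<lceil>K * \<rho>\<rceil> + 1" and cK: "c \<le> K"
  shows "c * \<rho> \<le> real (card ({x..<x + 2 * W} - good))"
proof (cases "\<exists>g h g'. x \<le> g \<and> g < h \<and> h < g' \<and> g' < x + 2 * W \<and> g \<in> good \<and> h \<notin> good \<and> g' \<in> good")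
  case True
  then obtain g h g' where *: "x \<le> g" "g < h" "h < g'" "g' < x + 2 * W" "g \<in> good" "h \<notin> good" "g' \<in> good"
    by blast
  have "{g..<g'} - good \<subseteq> {x..<x + 2 * W} - good" using * by auto
  then have "card ({g..<g'} - good) \<le> card ({x..<x + 2 * W} - good)"
    by (rule card_mono[rotated]) simp
  then show ?thesis using good_gap_long[OF pat *(2,3,5-7)] by linarith
next
  case no_pattern: False
  let ?G = "good \<inter> {x..<x + 2 * W}"
  have "card ?G \<le> W"
  proof (cases "?G = {}")
    case False
    define g g' where "g = Min ?G" and "g' = Max ?G"
    have fin: "finite ?G" by simp
    have g: "g \<in> ?G" "g' \<in> ?G" unfolding g_def g'_def using Min_in[OF fin False] Max_in[OF fin False] by auto
    have sub: "?G \<subseteq> {g..g'}" using Min_le[OF fin] Max_ge[OF fin] unfolding g_def g'_def by auto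
    have "{g..g'} \<subseteq> good"
    proof
      fix k assume k: "k \<in> {g..g'}"
      show "k \<in> good"
      proof (rule ccontr)
        assume "k \<notin> good"
        then have "g < k" "k < g'" using k g by (auto simp: order.order_iff_strict)
        moreover have "x \<le> g" "g' < x + 2 * W" "g \<in> good" "g' \<in> good" using g by auto
        ultimately show False using \<open>k \<notin> good\<close> no_pattern by blast
      qed
    qed
    moreover have "g \<le> g'" using g(1) sub by auto
    ultimately have "real g' \<le> real g + K * \<rho>"
      using good_run_short[OF pat, of g g'] by simp
    then have "g' + 1 - g \<le> W" unfolding W by linarith
    moreover have "card ?G \<le> card {g..g'}" by (rule card_mono) (use sub in auto)
    ultimately show ?thesis by simp
  qed simp
  moreover have "card ({x..<x + 2 * W} - good) = card {x..<x + 2 * W} - card ?G"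
    by (subst card_Diff_subset_Int) (auto simp: Int_commute)
  ultimately have "W \<le> card ({x..<x + 2 * W} - good)" by simp
  moreover have "c * \<rho> \<le> K * \<rho>" using cK \<open>2 \<le> \<rho>\<close> by (intro mult_right_mono) auto
  ultimately show ?thesis unfolding W by linarith
qed

text \<open>Blocks of length of order \<open>(K + 1) * \<rho>\<close> each contain
  \<open>c * \<rho>\<close> bad positions, so \<open>\<rho>\<close> cancels and the density bound is
  uniform in the distance of the two orbits. When \<open>q\<close> is too short for one block, the
  given gap supplies the bad positions.\<close>

lemma bad_density:
  assumes pat: "exchange_pattern K c \<rho> s s'" and K: "0 \<le> K" and c: "0 \<le> c" and \<rho>: "2 \<le> \<rho>"
    and cK: "c \<le> K"
    and gap: "g < h" "h < g'" "g \<in> good" "h \<notin> good" "g' \<in> good"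
  shows "c / (4 * (K + 1)) * real q \<le> real (card ({..<q} - good))"
proof -
  define W where "W = nat \<lceil>K * \<rho>\<rceil> + 1"
  define M where "M = 2 * W"
  have "0 \<le> K * \<rho>" using K \<rho> by simp
  then have "real W \<le> K * \<rho> + 2" unfolding W_def by linarith
  also have "\<dots> \<le> (K + 1) * \<rho>" using \<rho> by (simp add: algebra_simps)
  finally have M: "real M \<le> 2 * (K + 1) * \<rho>" unfolding M_def mult.assoc by simp
  have M0: "0 < M" by (simp add: M_def W_def)
  have one: "c * \<rho> \<le> real (card ({..<q} - good))"
  proof -
    have "{g..<g'} - good \<subseteq> {..<q} - good" using gap by (auto simp: good_def)
    then have "card ({g..<g'} - good) \<le> card ({..<q} - good)"
      by (rule card_mono[rotated]) simp
    then show ?thesis using good_gap_long[OF pat gap] by linarith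
  qed
  have many: "real (q div M) * (c * \<rho>) \<le> real (card ({..<q} - good))"
  proof -
    have "real (q div M) * (c * \<rho>) \<le> real (card ((- good) \<inter> {0..<q div M * M}))"
    proof (rule card_Int_blocks_ge)
      fix x assume "x + M \<le> q"
      then show "c * \<rho> \<le> real (card (- good \<inter> {x..<x + M}))"
        using bad_in_window[OF pat \<rho> W_def cK, of x] by (simp add: M_def Diff_eq Int_commute)
    qed simp
    moreover have "card ((- good) \<inter> {0..<q div M * M}) \<le> card ({..<q} - good)"
      by (rule card_mono) (auto intro: less_le_trans[OF _ div_times_less_eq_dividend])
    ultimately show ?thesis by linarith
  qed
  \<comment> \<open>The factor 2 absorbs the incomplete last block, the maximum the case of no full
    block.\<close>
  have "real q \<le> 2 * real M * max 1 (real (q div M))"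
  proof (cases "q < M")
    case True
    then show ?thesis by simp
  next
    case False
    then have 1: "1 \<le> q div M" using M0 by (simp add: div_greater_zero_iff Suc_le_eq)
    have "q < M * (q div M) + M" using M0 by (metis add_less_cancel_left mod_less_divisor mult_div_mod_eq)
    also have "\<dots> \<le> M * (q div M) + M * (q div M)" using 1 by simp
    finally have "real q \<le> real (2 * M * (q div M))" by (simp only: of_nat_le_iff)
    then show ?thesis using 1 by simp
  qed
  then have "c / (4 * (K + 1)) * real q \<le> c / (4 * (K + 1)) * (2 * real M * max 1 (real (q div M)))"
    using c K by (intro mult_left_mono) auto
  also have "\<dots> \<le> c / (4 * (K + 1)) * (2 * (2 * (K + 1) * \<rho>) * max 1 (real (q div M)))"
    using c K M by (intro mult_left_mono mult_right_mono) auto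
  also have "\<dots> = max 1 (real (q div M)) * (c * \<rho>)"
    using K by (simp add: field_simps)
  also have "\<dots> \<le> real (card ({..<q} - good))"
    using one many by (simp add: max_def)
  finally show ?thesis .
qed

text \<open>Settles the case of identical codings, where no exchange pattern is available.\<close>

lemma good_upward_if_sides_agree:
  assumes "\<And>n. s n = s' n" "g \<in> good" "g \<le> h" "h < q"
  shows "h \<in> good"
  using assms(3,4)
proof (induction h rule: dec_induct)
  case base
  show ?case by (rule assms)
next
  case (step h)
  then have "h \<in> good" by simp
  then have "\<forall>i\<in>{1..e}. a i (Suc h) = b i (Suc h)"
    using good_Suc[OF _ step.prems] by blast
  then show ?case using assms(1) step.prems unfolding good_def by blast
qed

end

section \<open>Words of the language\<close>

lemma sq_tiled_iet_funpow_fst: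
  assumes "0 \<le> x" "x < 1"
  shows "fst ((sq_tiled_iet \<alpha> p r ^^ n) (x, i)) = frac (x + real n * \<alpha>)"
proof (induction n)
  case 0
  then show ?case using assms by (simp add: frac_eq)
next
  case (Suc n)
  then show ?case
    by (simp add: sq_tiled_iet_def case_prod_beta algebra_simps)
qed

lemma sq_tiled_iet_mem:
  assumes "p permutes {1..d}" "r permutes {1..d}" "z \<in> {0..<1} \<times> {1..d}"
  shows "sq_tiled_iet \<alpha> p r z \<in> {0..<1} \<times> {1..d}"
proof -
  have "inv p i \<in> {1..d}" "inv r i \<in> {1..d}" if "i \<in> {1..d}" for i
    using that permutes_in_image[OF permutes_inv[OF assms(1)]] permutes_in_image[OF permutes_inv[OF assms(2)]]
    by auto
  then show ?thesis
    using assms(3) by (cases z) (auto simp: sq_tiled_iet_def frac_lt_1)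
qed

lemma sq_tiled_iet_funpow_mem:
  assumes "p permutes {1..d}" "r permutes {1..d}" "z \<in> {0..<1} \<times> {1..d}"
  shows "(sq_tiled_iet \<alpha> p r ^^ n) z \<in> {0..<1} \<times> {1..d}"
proof (induction n)
  case (Suc n)
  then show ?case using sq_tiled_iet_mem[OF assms(1,2)] by simp
qed (use assms(3) in simp)

text \<open>The starting time of the factor is absorbed into \<open>x\<close>, so every word is
  coded from time 0.\<close>

lemma language_wordE:
  assumes "p permutes {1..d}" "r permutes {1..d}" "w \<in> language d \<alpha> p r"
  obtains x where
    "\<And>n. n < length w \<Longrightarrow> snd (w ! n) = rotation_side \<alpha> (x + real n * \<alpha>)"
    "\<And>n. n < length w \<Longrightarrow> fst (w ! n) \<in> {1..d}"
    "\<And>n. Suc n < length w \<Longrightarrow>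
      (if snd (w ! n) = L then p else r) (fst (w ! Suc n)) = fst (w ! n)"
proof -
  obtain z k m where z: "z \<in> {0..<1} \<times> {1..d}" and w: "w = map (trajectory \<alpha> p r z) [k..<k + m]"
    using assms(3) unfolding language_def by blast
  obtain x i where xi: "z = (x, i)" "0 \<le> x" "x < 1" using z by (cases z) auto
  have nth: "w ! n = letter_of \<alpha> ((sq_tiled_iet \<alpha> p r ^^ (k + n)) z)" if "n < length w" for n
    using that by (simp add: w trajectory_def)
  show ?thesis
  proof (rule that[of "x + real k * \<alpha>"])
    fix n assume n: "n < length w"
    have "fst ((sq_tiled_iet \<alpha> p r ^^ (k + n)) z) = frac (x + real k * \<alpha> + real n * \<alpha>)"
      unfolding xi(1) sq_tiled_iet_funpow_fst[OF xi(2,3)] by (simp add: algebra_simps)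
    then show "snd (w ! n) = rotation_side \<alpha> (x + real k * \<alpha> + real n * \<alpha>)"
      unfolding nth[OF n] by (simp add: letter_of_def case_prod_beta rotation_side_def)
    show "fst (w ! n) \<in> {1..d}"
      using sq_tiled_iet_funpow_mem[OF assms(1,2) z, where n = "k + n" and \<alpha> = \<alpha>]
      unfolding nth[OF n] by (auto simp: letter_of_def case_prod_beta)
  next
    fix n assume n: "Suc n < length w"
    obtain y j where yj: "(sq_tiled_iet \<alpha> p r ^^ (k + n)) z = (y, j)" by fastforce
    have "w ! n = letter_of \<alpha> (y, j)" "w ! Suc n = letter_of \<alpha> (sq_tiled_iet \<alpha> p r (y, j))"
      using nth[of n] nth[of "Suc n"] n yj by simp_all
    then show "(if snd (w ! n) = L then p else r) (fst (w ! Suc n)) = fst (w ! n)"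
      by (simp add: letter_of_def sq_tiled_iet_def permutes_inverses[OF assms(1)] permutes_inverses[OF assms(2)])
  qed
qed

section \<open>Subwords, mean distances and the three intervals\<close>

lemma nths_cong_nth:
  assumes "length xs = length ys" "\<And>k. k < length xs \<Longrightarrow> k \<in> A \<Longrightarrow> xs ! k = ys ! k"
  shows "nths xs A = nths ys A"
  using assms
proof (induction xs ys arbitrary: A rule: list_induct2)
  case (Cons x xs y ys)
  have "nths xs {j. Suc j \<in> A} = nths ys {j. Suc j \<in> A}"
    using Cons.prems[of "Suc _"] by (intro Cons.IH) auto
  moreover have "0 \<in> A \<Longrightarrow> x = y" using Cons.prems[of 0] by simp
  ultimately show ?case by (simp add: nths_Cons)
qed simp

lemma subword_prefix: "subword w {1..m} = take m w"
proof -
  have "{k. Suc k \<in> {1..m}} = {..<m}" by auto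
  then show ?thesis by (simp add: subword_def)
qed

lemma subword_suffix: "subword w {n + 1..length w} = drop n w"
  unfolding subword_def drop_eq_nths
  by (simp add: nths_def) (rule arg_cong[where f = "map fst"], rule filter_cong, auto dest: set_zip_rightD)

text \<open>Union bound: a position where some pair differs is counted at least once in the
  sum.\<close>

lemma dbar_sum_ge:
  fixes v v' :: "nat \<Rightarrow> 'a list"
  assumes "finite E" "\<And>i. i \<in> E \<Longrightarrow> length (v i) = n"
  shows "real (card {k. k < n \<and> (\<exists>i\<in>E. v i ! k \<noteq> v' i ! k)}) / real n \<le> (\<Sum>i\<in>E. dbar (v i) (v' i))"
proof -
  have "{k. k < n \<and> (\<exists>i\<in>E. v i ! k \<noteq> v' i ! k)} = (\<Union>i\<in>E. {k. k < n \<and> v i ! k \<noteq> v' i ! k})"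
    by auto
  then have "card {k. k < n \<and> (\<exists>i\<in>E. v i ! k \<noteq> v' i ! k)} \<le> (\<Sum>i\<in>E. card {k. k < n \<and> v i ! k \<noteq> v' i ! k})"
    using card_UN_le[OF assms(1)] by metis
  then have "real (card {k. k < n \<and> (\<exists>i\<in>E. v i ! k \<noteq> v' i ! k)}) / real n \<le>
      real (\<Sum>i\<in>E. card {k. k < n \<and> v i ! k \<noteq> v' i ! k}) / real n"
    by (rule divide_right_mono[OF of_nat_mono]) simp
  also have "\<dots> = (\<Sum>i\<in>E. dbar (v i) (v' i))"
    using assms(2) by (simp add: dbar_def sum_divide_distrib)
  finally show ?thesis .
qed

lemma dbar_sum_ge_1:
  fixes v v' :: "nat \<Rightarrow> 'a list"
  assumes "finite E" "\<And>i. i \<in> E \<Longrightarrow> length (v i) = n" "0 < n"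
    and "\<And>k. k < n \<Longrightarrow> \<exists>i\<in>E. v i ! k \<noteq> v' i ! k"
  shows "1 \<le> (\<Sum>i\<in>E. dbar (v i) (v' i))"
proof -
  have "{k. k < n \<and> (\<exists>i\<in>E. v i ! k \<noteq> v' i ! k)} = {..<n}" using assms(4) by auto
  then show ?thesis using dbar_sum_ge[where v = v and v' = v', OF assms(1,2)] assms(3) by simp
qed

text \<open>Convexity makes \<open>G\<close> an interval. Each position outside it carries a
  mismatch of some pair, which gives both lower bounds by 1, and counting these positions gives the
  size of the middle interval.\<close>

lemma three_interval_decomposition:
  fixes v v' :: "nat \<Rightarrow> 'a list" and G :: "nat set"
  assumes "finite E" and len: "\<And>i. i \<in> E \<Longrightarrow> length (v i) = q" "\<And>i. i \<in> E \<Longrightarrow> length (v' i) = q"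
    and G: "G = {k. k < q \<and> (\<forall>i\<in>E. v i ! k = v' i ! k)}" "G \<noteq> {}"
    and convex: "\<And>g h g'. g \<in> G \<Longrightarrow> g' \<in> G \<Longrightarrow> g < h \<Longrightarrow> h < g' \<Longrightarrow> h \<in> G"
  shows "\<exists>m n I\<^sub>1 J\<^sub>1 I\<^sub>2. m \<le> n \<and> n \<le> q \<and>
    I\<^sub>1 = {1..m} \<and> J\<^sub>1 = {m + 1..n} \<and> I\<^sub>2 = {n + 1..q} \<and>
    (\<forall>i\<in>E. subword (v i) J\<^sub>1 = subword (v' i) J\<^sub>1) \<and>
    (I\<^sub>1 \<noteq> {} \<longrightarrow> (\<Sum>i\<in>E. dbar (subword (v i) I\<^sub>1) (subword (v' i) I\<^sub>1)) \<ge> 1) \<and>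
    (I\<^sub>2 \<noteq> {} \<longrightarrow> (\<Sum>i\<in>E. dbar (subword (v i) I\<^sub>2) (subword (v' i) I\<^sub>2)) \<ge> 1) \<and>
    real (card J\<^sub>1) \<ge> real q * (1 - (\<Sum>i\<in>E. dbar (v i) (v' i)))"
proof -
  have Gq: "G \<subseteq> {..<q}" unfolding G(1) by auto
  have fin: "finite G" unfolding G(1) by simp
  \<comment> \<open>List positions \<open>{m..<n}\<close> correspond to \<open>{m + 1..n}\<close>
    when counted from 1.\<close>
  define m n where "m = Min G" and "n = Suc (Max G)"
  have mG: "m \<in> G" and nG: "Max G \<in> G" unfolding m_def using Min_in[OF fin G(2)] Max_in[OF fin G(2)] by auto
  have mn: "m \<le> n" "n \<le> q" "m < q"
    using subsetD[OF Gq mG] subsetD[OF Gq nG] Max_ge[OF fin mG] by (auto simp: n_def)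
  have G_eq: "G = {m..<n}"
  proof
    show "G \<subseteq> {m..<n}" using Min_le[OF fin] Max_ge[OF fin] by (auto simp: m_def n_def less_Suc_eq_le)
    show "{m..<n} \<subseteq> G"
    proof
      fix k assume k: "k \<in> {m..<n}"
      show "k \<in> G"
      proof (cases "k = m \<or> k = Max G")
        case False
        then show ?thesis using k by (intro convex[OF mG nG]) (auto simp: n_def)
      qed (use mG nG in auto)
    qed
  qed
  have mismatch: "\<exists>i\<in>E. v i ! k \<noteq> v' i ! k" if "k < q" "k \<notin> {m..<n}" for k
    using that unfolding G_eq[symmetric] unfolding G(1) by auto
  have a: "subword (v i) {m + 1..n} = subword (v' i) {m + 1..n}" if "i \<in> E" for i
    unfolding subword_def
  proof (rule nths_cong_nth)
    fix k assume "k \<in> {k. Suc k \<in> {m + 1..n}}"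
    then have "k \<in> G" unfolding G_eq by auto
    then show "v i ! k = v' i ! k" using that by (simp add: G(1))
  qed (use len that in simp)
  have b: "1 \<le> (\<Sum>i\<in>E. dbar (subword (v i) {1..m}) (subword (v' i) {1..m}))" if "{1..m} \<noteq> {}"
    unfolding subword_prefix
  proof (rule dbar_sum_ge_1[OF assms(1)])
    fix k assume "k < m"
    then show "\<exists>i\<in>E. take m (v i) ! k \<noteq> take m (v' i) ! k"
      using mismatch[of k] mn by auto
  qed (use that len mn in auto)
  have c: "1 \<le> (\<Sum>i\<in>E. dbar (subword (v i) {n + 1..q}) (subword (v' i) {n + 1..q}))" if "{n + 1..q} \<noteq> {}"
  proof -
    have "(\<Sum>i\<in>E. dbar (subword (v i) {n + 1..q}) (subword (v' i) {n + 1..q})) =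
        (\<Sum>i\<in>E. dbar (drop n (v i)) (drop n (v' i)))"
    proof (rule sum.cong[OF refl])
      fix i assume "i \<in> E"
      then show "dbar (subword (v i) {n + 1..q}) (subword (v' i) {n + 1..q}) = dbar (drop n (v i)) (drop n (v' i))"
        using subword_suffix[of "v i" n] subword_suffix[of "v' i" n] len by simp
    qed
    moreover have "1 \<le> (\<Sum>i\<in>E. dbar (drop n (v i)) (drop n (v' i)))"
    proof (rule dbar_sum_ge_1[OF assms(1)])
      fix k assume k: "k < q - n"
      then have "n + k < q" "n + k \<notin> {m..<n}" by auto
      then obtain i where "i \<in> E" "v i ! (n + k) \<noteq> v' i ! (n + k)"
        using mismatch by blast
      then show "\<exists>i\<in>E. drop n (v i) ! k \<noteq> drop n (v' i) ! k"
        using len mn by (auto simp: nth_drop)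
    qed (use that len in auto)
    ultimately show ?thesis by simp
  qed
  have "real (card {k. k < q \<and> (\<exists>i\<in>E. v i ! k \<noteq> v' i ! k)}) / real q \<le> (\<Sum>i\<in>E. dbar (v i) (v' i))"
    by (rule dbar_sum_ge[OF assms(1) len(1)])
  moreover have "{k. k < q \<and> (\<exists>i\<in>E. v i ! k \<noteq> v' i ! k)} = {..<q} - {m..<n}"
    unfolding G_eq[symmetric] unfolding G(1) by auto
  moreover have "card ({..<q} - {m..<n}) = q - (n - m)"
    using mn by (subst card_Diff_subset) auto
  ultimately have "real (q - (n - m)) / real q \<le> (\<Sum>i\<in>E. dbar (v i) (v' i))" by simp
  then have "real q * (1 - (\<Sum>i\<in>E. dbar (v i) (v' i))) \<le> real (n - m)"
    using mn by (simp add: field_simps of_nat_diff)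
  then have J: "real q * (1 - (\<Sum>i\<in>E. dbar (v i) (v' i))) \<le> real (card {m + 1..n})" by simp
  show ?thesis
    by (rule exI[of _ m], rule exI[of _ n], rule exI[of _ "{1..m}"], rule exI[of _ "{m + 1..n}"],
        rule exI[of _ "{n + 1..q}"]) (intro conjI refl ballI impI mn a b c J)
qed

section \<open>Choice of the constant and conclusion\<close>

theorem proposition8:
  fixes d :: nat and p\<^sub>l p\<^sub>r :: "nat \<Rightarrow> nat" and \<alpha> :: real
  assumes "p\<^sub>l permutes {1..d}" and "p\<^sub>r permutes {1..d}"
    and "0 < \<alpha>" and "\<alpha> < 1" and "\<alpha> \<notin> \<rat>"
    and "bounded_partial_quotients \<alpha>"
  shows "\<exists>C::real. C > 0 \<and>
    (\<forall>e::nat. e \<le> d \<and> e \<ge> 1 + card {i \<in> {1..d}. p\<^sub>l (p\<^sub>r i) = p\<^sub>r (p\<^sub>l i)} \<longrightarrow>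
      (\<forall>(v :: nat \<Rightarrow> letter list) (v' :: nat \<Rightarrow> letter list) (q::nat) (u :: side list) (u' :: side list).
        q \<ge> 1 \<and>
        (\<forall>i\<in>{1..e}. v i \<in> language d \<alpha> p\<^sub>l p\<^sub>r \<and> v' i \<in> language d \<alpha> p\<^sub>l p\<^sub>r \<and>
                     length (v i) = q \<and> length (v' i) = q) \<and>
        (\<Sum>i=1..e. dbar (v i) (v' i)) < C \<and>
        (\<forall>i\<in>{1..e}. side_word (v i) = u) \<and>
        (\<forall>i\<in>{1..e}. side_word (v' i) = u') \<and>
        (\<forall>i\<in>{1..e}. \<forall>j\<in>{1..e}. i \<noteq> j \<longrightarrow> v i \<noteq> v j) \<longrightarrow>
        (\<exists>m n I\<^sub>1 J\<^sub>1 I\<^sub>2. m \<le> n \<and> n \<le> q \<and>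
          I\<^sub>1 = {1..m} \<and> J\<^sub>1 = {m + 1..n} \<and> I\<^sub>2 = {n + 1..q} \<and>
          (\<forall>i\<in>{1..e}. subword (v i) J\<^sub>1 = subword (v' i) J\<^sub>1) \<and>
          (I\<^sub>1 \<noteq> {} \<longrightarrow> (\<Sum>i=1..e. dbar (subword (v i) I\<^sub>1) (subword (v' i) I\<^sub>1)) \<ge> 1) \<and>
          (I\<^sub>2 \<noteq> {} \<longrightarrow> (\<Sum>i=1..e. dbar (subword (v i) I\<^sub>2) (subword (v' i) I\<^sub>2)) \<ge> 1) \<and>
          real (card J\<^sub>1) \<ge> real q * (1 - (\<Sum>i=1..e. dbar (v i) (v' i))))))"
proof -
  obtain K c\<^sub>0 where K: "0 < K" and c\<^sub>0: "0 < c\<^sub>0" and dich: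
    "\<And>x x'. (\<forall>n. rotation_side \<alpha> (x + real n * \<alpha>) = rotation_side \<alpha> (x' + real n * \<alpha>)) \<or>
      (\<exists>\<rho>\<ge>2. exchange_pattern K c\<^sub>0 \<rho> (\<lambda>n. rotation_side \<alpha> (x + real n * \<alpha>))
        (\<lambda>n. rotation_side \<alpha> (x' + real n * \<alpha>)))"
    using rotation_side_dichotomy[OF assms(3-6)] by blast
  \<comment> \<open>Shrinking \<open>c\<close> keeps the pattern and provides
    \<open>c \<le> K\<close> for the window count.\<close>
  define c where "c = min c\<^sub>0 K"
  have c: "0 < c" "c \<le> K" "c \<le> c\<^sub>0" using K c\<^sub>0 by (auto simp: c_def)
  \<comment> \<open>The bound 1 forces at least one good position; the other is the density that a
    bad position between two good ones would produce.\<close>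
  define C where "C = min 1 (c / (4 * (K + 1)))"
  have "0 < C" using K c by (simp add: C_def)
  have main: "\<exists>m n I\<^sub>1 J\<^sub>1 I\<^sub>2. m \<le> n \<and> n \<le> q \<and>
          I\<^sub>1 = {1..m} \<and> J\<^sub>1 = {m + 1..n} \<and> I\<^sub>2 = {n + 1..q} \<and>
          (\<forall>i\<in>{1..e}. subword (v i) J\<^sub>1 = subword (v' i) J\<^sub>1) \<and>
          (I\<^sub>1 \<noteq> {} \<longrightarrow> (\<Sum>i=1..e. dbar (subword (v i) I\<^sub>1) (subword (v' i) I\<^sub>1)) \<ge> 1) \<and>
          (I\<^sub>2 \<noteq> {} \<longrightarrow> (\<Sum>i=1..e. dbar (subword (v i) I\<^sub>2) (subword (v' i) I\<^sub>2)) \<ge> 1) \<and>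
          real (card J\<^sub>1) \<ge> real q * (1 - (\<Sum>i=1..e. dbar (v i) (v' i)))"
    if e: "1 + card {i \<in> {1..d}. p\<^sub>l (p\<^sub>r i) = p\<^sub>r (p\<^sub>l i)} \<le> e" and q: "1 \<le> q"
      and v: "\<forall>i\<in>{1..e}. v i \<in> language d \<alpha> p\<^sub>l p\<^sub>r \<and> v' i \<in> language d \<alpha> p\<^sub>l p\<^sub>r \<and>
                     length (v i) = q \<and> length (v' i) = q"
      and small: "(\<Sum>i=1..e. dbar (v i) (v' i)) < C"
      and u: "\<forall>i\<in>{1..e}. side_word (v i) = u" and u': "\<forall>i\<in>{1..e}. side_word (v' i) = u'"
      and distinct: "\<forall>i\<in>{1..e}. \<forall>j\<in>{1..e}. i \<noteq> j \<longrightarrow> v i \<noteq> v j"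
    for e q :: nat and v v' :: "nat \<Rightarrow> letter list" and u u' :: "side list"
  proof -
    have 1: "1 \<in> {1..e}" using e by simp
    \<comment> \<open>The first pair of words alone fixes the two rotation orbits, since all
      \<open>v i\<close> share one side word and all \<open>v' i\<close> another.\<close>
    obtain x where x: "\<And>n. n < q \<Longrightarrow> snd (v 1 ! n) = rotation_side \<alpha> (x + real n * \<alpha>)"
      using language_wordE[OF assms(1,2)] v 1 by metis
    obtain x' where x': "\<And>n. n < q \<Longrightarrow> snd (v' 1 ! n) = rotation_side \<alpha> (x' + real n * \<alpha>)"
      using language_wordE[OF assms(1,2)] v 1 by metis
    define s s' where "s = (\<lambda>n. rotation_side \<alpha> (x + real n * \<alpha>))"
      and "s' = (\<lambda>n. rotation_side \<alpha> (x' + real n * \<alpha>))"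
    have snd_v: "snd (v i ! n) = s n" if "i \<in> {1..e}" "n < q" for i n
    proof -
      have "side_word (v i) ! n = side_word (v 1) ! n" using u 1 that by simp
      then show ?thesis using v 1 that x by (simp add: side_word_def s_def)
    qed
    have snd_v': "snd (v' i ! n) = s' n" if "i \<in> {1..e}" "n < q" for i n
    proof -
      have "side_word (v' i) ! n = side_word (v' 1) ! n" using u' 1 that by simp
      then show ?thesis using v 1 that x' by (simp add: side_word_def s'_def)
    qed
    define P where "P = (\<lambda>\<sigma>. if \<sigma> = L then p\<^sub>l else p\<^sub>r)"
    interpret coded_orbits d q e P s s' "\<lambda>i n. fst (v i ! n)" "\<lambda>i n. fst (v' i ! n)"
    proof
      show "P \<sigma> permutes {1..d}" for \<sigma> using assms(1,2) by (simp add: P_def)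
      show "fst (v i ! n) \<in> {1..d}" if "i \<in> {1..e}" "n < q" for i n
        using language_wordE[OF assms(1,2)] v that by metis
      show "P (s n) (fst (v i ! Suc n)) = fst (v i ! n)" if "i \<in> {1..e}" "Suc n < q" for i n
      proof -
        have "(if snd (v i ! n) = L then p\<^sub>l else p\<^sub>r) (fst (v i ! Suc n)) = fst (v i ! n)"
          using language_wordE[OF assms(1,2)] v that by metis
        then show ?thesis using snd_v[of i n] that by (simp add: P_def)
      qed
      show "P (s' n) (fst (v' i ! Suc n)) = fst (v' i ! n)" if "i \<in> {1..e}" "Suc n < q" for i n
      proof -
        have "(if snd (v' i ! n) = L then p\<^sub>l else p\<^sub>r) (fst (v' i ! Suc n)) = fst (v' i ! n)"
          using language_wordE[OF assms(1,2)] v that by metis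
        then show ?thesis using snd_v'[of i n] that by (simp add: P_def)
      qed
      show "\<exists>n<q. fst (v i ! n) \<noteq> fst (v j ! n)" if ij: "i \<in> {1..e}" "j \<in> {1..e}" "i \<noteq> j" for i j
      proof -
        \<comment> \<open>Distinct words with the same sides must differ in an index.\<close>
        obtain n where "n < q" "v i ! n \<noteq> v j ! n"
          using distinct v ij nth_equalityI[of "v i" "v j"] by metis
        then show ?thesis using snd_v ij by (metis prod_eqI)
      qed
      show "1 + card {i \<in> {1..d}. P L (P R i) = P R (P L i)} \<le> e" using e by (simp add: P_def)
    qed
    have good_eq: "good = {k. k < q \<and> (\<forall>i\<in>{1..e}. v i ! k = v' i ! k)}"
    proof (rule set_eqI)
      fix k
      have "(v i ! k = v' i ! k) = (s k = s' k \<and> fst (v i ! k) = fst (v' i ! k))"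
        if "i \<in> {1..e}" "k < q" for i
        using snd_v[OF that] snd_v'[OF that] by (auto simp: prod_eq_iff)
      then show "k \<in> good \<longleftrightarrow> k \<in> {k. k < q \<and> (\<forall>i\<in>{1..e}. v i ! k = v' i ! k)}"
        using 1 unfolding good_def by blast
    qed
    have bad: "real (card ({..<q} - good)) < C * real q"
    proof -
      have "{..<q} - good = {k. k < q \<and> (\<exists>i\<in>{1..e}. v i ! k \<noteq> v' i ! k)}"
        unfolding good_eq by auto
      then have "real (card ({..<q} - good)) / real q \<le> (\<Sum>i=1..e. dbar (v i) (v' i))"
        using dbar_sum_ge[of "{1..e}" v q v'] v by simp
      then have "real (card ({..<q} - good)) / real q < C" using small by simp
      then show ?thesis using q by (simp add: field_simps)
    qed
    show ?thesis
    proof (rule three_interval_decomposition[OF _ _ _ good_eq])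
      have "C * real q \<le> 1 * real q" by (rule mult_right_mono) (simp_all add: C_def)
      then show "good \<noteq> {}" using bad by auto
    next
      fix g h g'
      assume gh: "g \<in> good" "g' \<in> good" "g < h" "h < g'"
      show "h \<in> good"
      proof (rule ccontr)
        assume h: "h \<notin> good"
        have hq: "h < q" using gh by (simp add: good_def)
        have "\<not> (\<forall>n. s n = s' n)"
          using good_upward_if_sides_agree[OF _ gh(1), of h] gh(3) hq h by auto
        then obtain \<rho> where \<rho>: "2 \<le> \<rho>" "exchange_pattern K c\<^sub>0 \<rho> s s'"
          using dich[of x x'] unfolding s_def s'_def by blast
        then have "exchange_pattern K c \<rho> s s'"
          by (rule exchange_pattern_mono) (use c in auto)
        then have "c / (4 * (K + 1)) * real q \<le> real (card ({..<q} - good))"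
          using bad_density[OF _ _ _ \<rho>(1) c(2) gh(3,4,1) h gh(2)] K c by simp
        moreover have "C * real q \<le> c / (4 * (K + 1)) * real q"
          by (intro mult_right_mono) (auto simp: C_def)
        ultimately show False using bad by linarith
      qed
    qed (use v in auto)
  qed
  show ?thesis
    by (intro exI[of _ C] conjI allI impI) (rule \<open>0 < C\<close>, elim conjE, rule main, assumption+)
qed

end
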